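(* Let $0^{s_1}1^{t_1}\cdots0^{s_k}1^{t_k}$ be the binary string of a connected threshold graph $\Gamma$, and let $s=\sum_i s_i$ and $t=\sum_i t_i$. Then 1. $n_-(\mathcal{A})=t$, 2. $n_0(\mathcal{A})=s-k$, 3. $n_+(\mathcal{A})=k$.
   Context: Binary strings: a threshold graph with binary string $b=b_1\ldots b_n$ (where $b_1=0$) is the simple graph on vertices $1,\dots,n$ built by adding vertices in order, vertex $i\ge 2$ being added as an isolated vertex if $b_i=0$ and as a dominating vertex (adjacent to all earlier vertices) if $b_i=1$. A connected threshold graph on $n\ge 2$ vertices has $b_n=1$, and its string is written $0^{s_1}1^{t_1}\cdots0^{s_k}1^{t_k}$ with $k\ge1$ and all $s_i,t_i$ positive integers. The normalized adjacency matrix of $\Gamma$ is $\mathcal{A}=D^{-1}A$, where $A$ is the adjacency matrix and $D$ the diagonal matrix of vertex degrees; it is similar to the symmetric matrix $D^{-1/2}AD^{-1/2}$, so its eigenvalues are real. For a square matrix $M$ with real eigenvalues, $n_-(M)$ and $n_+(M)$ are the numbers of negative and positive eigenvalues of $M$ (counted with multiplicity) and $n_0(M)$ is the nullity of $M$. *)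

theory Defs
  imports
    "Graph_Theory.Graph_Theory"
    "Jordan_Normal_Form.Char_Poly"
    "Jordan_Normal_Form.Matrix_Kernel"
begin

text \<open>A simple graph is represented as a symmetric loop-free digraph (locale
  \<^locale>\<open>pair_graph\<close>): an edge between \<open>u\<close> and \<open>v\<close> is the pair of arcs \<open>(u, v)\<close> and \<open>(v, u)\<close>.\<close>

definition add_isolated :: "nat pair_pre_digraph \<Rightarrow> nat \<Rightarrow> nat pair_pre_digraph" where
  "add_isolated G v = \<lparr>pverts = insert v (pverts G), parcs = parcs G\<rparr>"

definition add_dominating :: "nat pair_pre_digraph \<Rightarrow> nat \<Rightarrow> nat pair_pre_digraph" where
  "add_dominating G v =
     \<lparr>pverts = insert v (pverts G), parcs = parcs G \<union> {v} \<times> pverts G \<union> pverts G \<times> {v}\<rparr>"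

text \<open>In a binary string, \<open>False\<close> stands for 0 and \<open>True\<close> for 1.  Lists are indexed from 0,
  so the letter of vertex \<open>i + 1\<close> is \<open>b ! i\<close>.  The first letter has no influence on the graph.\<close>

primrec threshold_upto :: "bool list \<Rightarrow> nat \<Rightarrow> nat pair_pre_digraph" where
  "threshold_upto b 0 = \<lparr>pverts = {}, parcs = {}\<rparr>"
| "threshold_upto b (Suc i) =
     (if b ! i then add_dominating (threshold_upto b i) (Suc i)
      else add_isolated (threshold_upto b i) (Suc i))"

definition threshold_graph :: "bool list \<Rightarrow> nat pair_pre_digraph" where
  "threshold_graph b = threshold_upto b (length b)"

text \<open>The string \<open>0\<^sup>s\<^sup>1 1\<^sup>t\<^sup>1 \<dots> 0\<^sup>s\<^sup>k 1\<^sup>t\<^sup>k\<close>, with block lengths \<open>s i\<close>, \<open>t i\<close> for \<open>1 \<le> i \<le> k\<close>.\<close>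

definition block_string :: "nat \<Rightarrow> (nat \<Rightarrow> nat) \<Rightarrow> (nat \<Rightarrow> nat) \<Rightarrow> bool list" where
  "block_string k s t = concat (map (\<lambda>i. replicate (s i) False @ replicate (t i) True) [1..<Suc k])"

text \<open>The following matrices are meant for graphs with vertex set \<open>{1..n}\<close>; row and column
  \<open>i\<close> (counted from 0) belong to vertex \<open>i + 1\<close>.\<close>

definition adjacency_matrix :: "nat pair_pre_digraph \<Rightarrow> real mat" where
  "adjacency_matrix G =
     mat (card (pverts G)) (card (pverts G)) (\<lambda>(i, j). if (Suc i, Suc j) \<in> parcs G then 1 else 0)"

definition degree_matrix :: "nat pair_pre_digraph \<Rightarrow> real mat" where
  "degree_matrix G = mat_diag (card (pverts G)) (\<lambda>i. real (out_degree G (Suc i)))"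

text \<open>This is the inverse of \<^const>\<open>degree_matrix\<close> if there are no isolated vertices; see
  \<open>inverts_degree_matrix\<close> below.\<close>

definition inverse_degree_matrix :: "nat pair_pre_digraph \<Rightarrow> real mat" where
  "inverse_degree_matrix G = mat_diag (card (pverts G)) (\<lambda>i. inverse (real (out_degree G (Suc i))))"

definition normalized_adjacency_matrix :: "nat pair_pre_digraph \<Rightarrow> real mat" where
  "normalized_adjacency_matrix G = inverse_degree_matrix G * adjacency_matrix G"

text \<open>Eigenvalues are counted with algebraic multiplicity, that is, their order as a root of the
  characteristic polynomial.  These are used for real matrices all of whose complex eigenvalues
  are real.\<close>

definition n_minus :: "real mat \<Rightarrow> nat" where
  "n_minus M = (\<Sum>x | eigenvalue M x \<and> x < 0. Polynomial.order x (char_poly M))"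

definition n_plus :: "real mat \<Rightarrow> nat" where
  "n_plus M = (\<Sum>x | eigenvalue M x \<and> x > 0. Polynomial.order x (char_poly M))"

definition n_zero :: "real mat \<Rightarrow> nat" where
  "n_zero M = kernel_dim M"

lemma inverts_degree_matrix:
  fixes G :: "nat pair_pre_digraph"
  assumes "\<And>i. i \<in> {1..card (pverts G)} \<Longrightarrow> out_degree G i \<noteq> 0"
  shows "inverts_mat (degree_matrix G) (inverse_degree_matrix G)"
    and "inverts_mat (inverse_degree_matrix G) (degree_matrix G)"
proof -
  have "degree_matrix G * inverse_degree_matrix G = 1\<^sub>m (card (pverts G))"
    "inverse_degree_matrix G * degree_matrix G = 1\<^sub>m (card (pverts G))"
    using assms by (auto simp: degree_matrix_def inverse_degree_matrix_def mat_diag_def intro!: eq_matI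
      simp del: mat_diag_diag simp: mat_diag_diag[unfolded mat_diag_def])
  moreover have "dim_row (degree_matrix G) = card (pverts G)"
    "dim_row (inverse_degree_matrix G) = card (pverts G)"
    by (simp_all add: degree_matrix_def inverse_degree_matrix_def mat_diag_def)
  ultimately show "inverts_mat (degree_matrix G) (inverse_degree_matrix G)"
    "inverts_mat (inverse_degree_matrix G) (degree_matrix G)"
    by (simp_all add: inverts_mat_def)
qed

lemma pverts_threshold_upto: "pverts (threshold_upto b m) = {1..m}"
  by (induction m) (auto simp: add_isolated_def add_dominating_def)

lemma pverts_threshold_graph: "pverts (threshold_graph b) = {1..length b}"
  by (simp add: threshold_graph_def pverts_threshold_upto)

lemma parcs_threshold_upto:
  "(u, v) \<in> parcs (threshold_upto b m) \<longleftrightarrow>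
     u \<in> {1..m} \<and> v \<in> {1..m} \<and> u \<noteq> v \<and> b ! (max u v - 1)"
  by (induction m) (auto simp: add_isolated_def add_dominating_def pverts_threshold_upto max_def le_Suc_eq)

lemma pair_graph_threshold_graph: "pair_graph (threshold_graph b)"
proof
  have sub: "parcs (threshold_graph b) \<subseteq> {1..length b} \<times> {1..length b}"
    by (auto simp: threshold_graph_def parcs_threshold_upto)
  then show "finite (parcs (threshold_graph b))"
    by (rule finite_subset) simp
  show "finite (pverts (threshold_graph b))"
    by (simp add: pverts_threshold_graph)
  show "symmetric (threshold_graph b)"
    by (auto simp: symmetric_def sym_def threshold_graph_def parcs_threshold_upto max.commute)
qed (auto simp: threshold_graph_def parcs_threshold_upto pverts_threshold_upto)

lemma connected_threshold_graph:
  assumes "b \<noteq> []" and "last b"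
  shows "connected (threshold_graph b)"
proof -
  interpret pair_graph "threshold_graph b" by (rule pair_graph_threshold_graph)
  let ?G = "with_proj (threshold_graph b)"
  let ?n = "length b"
  have n: "?n \<in> {1..?n}" using assms by (cases b) auto
  have adj: "(u, ?n) \<in> parcs (threshold_graph b)" "(?n, u) \<in> parcs (threshold_graph b)"
    if "u \<in> {1..?n}" "u \<noteq> ?n" for u
    using that assms by (auto simp: threshold_graph_def parcs_threshold_upto last_conv_nth max_def)
  have to: "u \<rightarrow>\<^sup>*\<^bsub>?G\<^esub> ?n" and from_: "?n \<rightarrow>\<^sup>*\<^bsub>?G\<^esub> u" if "u \<in> {1..?n}" for u
    using adj[OF that] that n
    by (cases "u = ?n"; auto simp: pverts_threshold_graph intro!: reachable_adjI)+
  show ?thesis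
    unfolding connected_def strongly_connected_def
    using n reachable_trans[OF to from_]
    by (auto simp: pverts_threshold_graph intro!: reachable_mk_symmetricI)
qed

lemma connected_block_string:
  assumes "k \<ge> 1" and "t k > 0"
  shows "connected (threshold_graph (block_string k s t))"
proof (rule connected_threshold_graph)
  have k: "[1..<Suc k] = [1..<k] @ [k]" using assms(1) by simp
  show "block_string k s t \<noteq> []" "last (block_string k s t)"
    using assms(2) unfolding block_string_def k by auto
qed

end

theory Submission
  imports Defs
    "Jordan_Normal_Form.Jordan_Normal_Form_Uniqueness"
    "Jordan_Normal_Form.Spectral_Radius"
begin

text \<open>The matrix \<open>D\<^sup>-\<^sup>1 A\<close> is self-adjoint for the inner product with Gram matrix \<open>D\<close>, so it is diagonalizable
over the reals and its numbers of negative, zero and positive eigenvalues are those of the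
quadratic form of \<open>A\<close> (Sylvester's law of inertia).  These three numbers add up to the number \<open>n\<close>
of vertices, so it suffices to bound each of them from below by a quantity such that the three bounds
also add up to \<open>n\<close>.  A lower bound for the number of negative (positive) eigenvalues is the
dimension of any subspace on which the form is negative (positive) definite, and a lower bound for
the nullity is the dimension of any subspace of the kernel of \<open>A\<close>.

In a binary string \<open>b\<close> with first letter 0 and last letter 1, two vertices \<open>i \<noteq> j\<close> are adjacent iff
the letter at \<open>max i j\<close> is 1 (positions are counted from 0).  The three subspaces are as follows.

  \<^item> The vertices with letter 1 and vertex 0 form a clique.  On vectors \<open>x\<close> supported there the form is
    \<open>(\<Sum> x\<^sub>i)\<^sup>2 - \<Sum> x\<^sub>i\<^sup>2\<close>, hence negative definite on those with \<open>\<Sum> x\<^sub>i = 0\<close>: one dimension for each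
    letter 1 (\<open>adj_negative_on_clique\<close>).

  \<^item> If the letters at \<open>j - 1\<close> and \<open>j\<close> are both 0, these vertices have the same neighbours, so
    \<open>e\<^sub>j - e\<^sub>j\<^sub>-\<^sub>1\<close> is in the kernel: one dimension for each factor 00 of the string
    (\<open>adj_null_on_double_zeros\<close>).

  \<^item> For each factor 01 of the string, take its two vertices.  With coordinates \<open>y\<^sub>j\<close> on the letters 0 and
    \<open>Y\<^sub>j = \<Sum>\<^sub>i\<^sub>\<le>\<^sub>j y\<^sub>i\<close> on the letters 1 of these factors, the form becomes \<open>\<Sum> Y\<^sub>j\<^sup>2 + (\<Sum> Y\<^sub>j)\<^sup>2\<close>, which
    is positive definite: one dimension for each factor 01 (\<open>adj_positive_on_rises\<close>).

Every letter 0 is followed by another letter, so the factors 00 and 01 are as many as the letters 0, and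
the three bounds do add up to \<open>n\<close> (\<open>card_positions\<close>).  In \<open>0\<^sup>s\<^sup>1 1\<^sup>t\<^sup>1 \<dots> 0\<^sup>s\<^sup>k 1\<^sup>t\<^sup>k\<close> there are \<open>k\<close> factors
01, one per block, and \<open>t\<close> letters 1, which leaves \<open>s - k\<close> factors 00.\<close>

section \<open>Homogeneous linear systems\<close>

text \<open>Gaussian elimination by induction on the set of equations: if an equation has a nonzero coefficient
at an unknown \<open>p\<close>, it is solved for that unknown, which is then eliminated from the others.\<close>

lemma homogeneous_system_nontrivial_solution:
  fixes c :: "'i \<Rightarrow> 'j \<Rightarrow> 'a :: field"
  assumes "finite I" "finite J" "card I < card J"
  shows "\<exists>y. (\<exists>j\<in>J. y j \<noteq> 0) \<and> (\<forall>i\<in>I. (\<Sum>j\<in>J. c i j * y j) = 0)"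
  using assms
proof (induction I arbitrary: J c rule: finite_induct)
  case empty
  then have "J \<noteq> {}" by auto
  then show ?case by (intro exI[of _ "\<lambda>_. 1"]) auto
next
  case (insert i I)
  show ?case
  proof (cases "\<forall>j\<in>J. c i j = 0")
    case True
    have "card I < card J" using insert by simp
    from insert.IH[OF insert.prems(1) this, of c] obtain y
      where "\<exists>j\<in>J. y j \<noteq> 0" "\<forall>l\<in>I. (\<Sum>j\<in>J. c l j * y j) = 0" by blast
    then show ?thesis using True by (intro exI[of _ y]) simp
  next
    case False
    then obtain p where p: "p \<in> J" "c i p \<noteq> 0" by auto
    let ?J = "J - {p}"
    have "card I < card ?J" using insert p by (simp add: card_Diff_singleton)
    from insert.IH[OF finite_Diff[OF insert.prems(1)] this, of "\<lambda>l j. c l j - c l p * c i j / c i p"]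
    obtain y where y: "\<exists>j\<in>?J. y j \<noteq> 0"
      and sol: "\<And>l. l \<in> I \<Longrightarrow> (\<Sum>j\<in>?J. (c l j - c l p * c i j / c i p) * y j) = 0"
      by blast
    define z where "z = y(p := - (\<Sum>j\<in>?J. c i j * y j) / c i p)"
    have split: "(\<Sum>j\<in>J. c l j * z j) = c l p * z p + (\<Sum>j\<in>?J. c l j * y j)" for l
      using insert.prems(1) p(1) by (subst sum.remove[of _ p]) (auto simp: z_def intro!: sum.cong)
    have "(\<Sum>j\<in>J. c i j * z j) = 0"
      unfolding split using p(2) by (simp add: z_def)
    moreover have "(\<Sum>j\<in>J. c l j * z j) = 0" if "l \<in> I" for l
    proof -
      have "(\<Sum>j\<in>?J. c l j * y j) - c l p / c i p * (\<Sum>j\<in>?J. c i j * y j) = 0"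
        using sol[OF that] by (simp add: sum_distrib_left sum_subtractf algebra_simps)
      then show ?thesis
        unfolding split using p(2) by (simp add: z_def field_simps)
    qed
    moreover have "\<exists>j\<in>J. z j \<noteq> 0" using y by (auto simp: z_def)
    ultimately show ?thesis by (intro exI[of _ z]) auto
  qed
qed

section \<open>The spectral theorem for real symmetric matrices\<close>

lemma scalar_prod_self_pos:
  fixes v :: "real vec"
  assumes "v \<in> carrier_vec n" "v \<noteq> 0\<^sub>v n"
  shows "v \<bullet> v > 0"
  using conjugate_square_greater_0_vec[OF assms(1)] assms by simp

text \<open>Let \<open>a + \<i> b\<close> be a complex eigenvector for the eigenvalue \<open>c\<close>.  Comparing real and imaginary parts gives
\<open>A a = Re c \<cdot> a - Im c \<cdot> b\<close> and \<open>A b = Im c \<cdot> a + Re c \<cdot> b\<close>, and the symmetry \<open>A a \<bullet> b = a \<bullet> A b\<close> turns this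
into \<open>Im c \<cdot> (a \<bullet> a + b \<bullet> b) = 0\<close>.  So \<open>c\<close> is real, and \<open>a\<close> and \<open>b\<close> are real eigenvectors unless they vanish.\<close>

lemma symmetric_real_mat_eigenvector:
  fixes A :: "real mat"
  assumes A: "A \<in> carrier_mat n n" and sym: "transpose_mat A = A" and n: "n > 0"
  shows "\<exists>v e. eigenvector A v e"
proof -
  let ?B = "map_mat complex_of_real A"
  have B: "?B \<in> carrier_mat n n" using A by simp
  from spectrum_non_empty[OF B n] obtain c v where "eigenvector ?B v c"
    by (auto simp: spectrum_def eigenvalue_def)
  then have v: "v \<in> carrier_vec n" "v \<noteq> 0\<^sub>v n" "?B *\<^sub>v v = c \<cdot>\<^sub>v v"
    using B by (auto simp: eigenvector_def)
  define a b where "a = map_vec Re v" and "b = map_vec Im v"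
  have ab: "a \<in> carrier_vec n" "b \<in> carrier_vec n" using v by (auto simp: a_def b_def)
  have row: "(\<Sum>j<n. complex_of_real (A $$ (i, j)) * v $ j) = c * v $ i" if "i < n" for i
    using arg_cong[OF v(3), of "\<lambda>x. x $ i"] that A v(1)
    by (simp add: scalar_prod_def lessThan_atLeast0)
  have Aa: "A *\<^sub>v a = Re c \<cdot>\<^sub>v a - Im c \<cdot>\<^sub>v b"
  proof (rule eq_vecI)
    fix i assume "i < dim_vec (Re c \<cdot>\<^sub>v a - Im c \<cdot>\<^sub>v b)"
    then have i: "i < n" using ab by simp
    show "(A *\<^sub>v a) $ i = (Re c \<cdot>\<^sub>v a - Im c \<cdot>\<^sub>v b) $ i"
      using arg_cong[OF row[OF i], of Re] i A v(1)
      by (simp add: scalar_prod_def lessThan_atLeast0 a_def b_def)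
  qed (use A ab in auto)
  have Ab: "A *\<^sub>v b = Im c \<cdot>\<^sub>v a + Re c \<cdot>\<^sub>v b"
  proof (rule eq_vecI)
    fix i assume "i < dim_vec (Im c \<cdot>\<^sub>v a + Re c \<cdot>\<^sub>v b)"
    then have i: "i < n" using ab by simp
    show "(A *\<^sub>v b) $ i = (Im c \<cdot>\<^sub>v a + Re c \<cdot>\<^sub>v b) $ i"
      using arg_cong[OF row[OF i], of Im] i A v(1)
      by (simp add: scalar_prod_def lessThan_atLeast0 a_def b_def)
  qed (use A ab in auto)
  have nz: "a \<noteq> 0\<^sub>v n \<or> b \<noteq> 0\<^sub>v n"
  proof (rule ccontr)
    assume "\<not> ?thesis"
    then have "a $ i = 0 \<and> b $ i = 0" if "i < n" for i using that by simp
    then have "v = 0\<^sub>v n"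
      using v(1) by (intro eq_vecI) (auto simp: a_def b_def complex_eq_iff)
    with v(2) show False by simp
  qed
  have "(A *\<^sub>v a) \<bullet> b = a \<bullet> (A *\<^sub>v b)"
    using transpose_vec_mult_scalar[OF A ab(2) ab(1)] sym by simp
  then have "Im c * (a \<bullet> a + b \<bullet> b) = 0"
    unfolding Aa Ab using ab
    by (simp add: minus_scalar_prod_distrib[of _ n] scalar_prod_add_distrib[of _ n] algebra_simps)
  moreover have "a \<bullet> a + b \<bullet> b > 0"
    using nz scalar_prod_self_pos[OF ab(1)] scalar_prod_self_pos[OF ab(2)] ab
    by (cases "a = 0\<^sub>v n"; cases "b = 0\<^sub>v n") (auto intro: add_pos_pos)
  ultimately have "Im c = 0" by simp
  then have "A *\<^sub>v a = Re c \<cdot>\<^sub>v a" "A *\<^sub>v b = Re c \<cdot>\<^sub>v b"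
    unfolding Aa Ab using ab by auto
  then show ?thesis using nz ab A by (auto simp: eigenvector_def)
qed

text \<open>The reflection in the hyperplane orthogonal to \<open>w = v - e\<^sub>0\<close> exchanges the unit vectors \<open>e\<^sub>0\<close> and \<open>v\<close>.
It serves to extend \<open>v\<close> to an orthonormal basis: \<open>v\<close> is the first column of the reflection, whose columns are orthonormal.\<close>

lemma householder_reflection:
  fixes v :: "real vec"
  assumes v: "v \<in> carrier_vec n" and unit: "v \<bullet> v = 1" and n: "n > 0"
  shows "\<exists>H. H \<in> carrier_mat n n \<and> transpose_mat H = H \<and> H * H = 1\<^sub>m n \<and> H *\<^sub>v unit_vec n 0 = v"
proof (cases "v = unit_vec n 0")
  case True
  then show ?thesis by (intro exI[of _ "1\<^sub>m n"]) auto
next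
  case False
  define w where "w = v - unit_vec n 0"
  define q where "q = w \<bullet> w"
  define r where "r = 2 / q"
  define H where "H = mat n n (\<lambda>(i, j). (if i = j then 1 else 0) - r * w $ i * w $ j)"
  have w: "w \<in> carrier_vec n" using v by (simp add: w_def)
  have w_eq: "w $ i = v $ i - (if i = 0 then 1 else 0)" if "i < n" for i
    using that v by (simp add: w_def)
  have "w \<noteq> 0\<^sub>v n"
  proof
    assume 0: "w = 0\<^sub>v n"
    have "v $ i = unit_vec n 0 $ i" if "i < n" for i
      using w_eq[OF that] that unfolding 0 by simp
    then have "v = unit_vec n 0" using v by (intro eq_vecI) auto
    with False show False ..
  qed
  then have q0: "q \<noteq> 0" using scalar_prod_self_pos[OF w] by (simp add: q_def)
  have q_sum: "(\<Sum>l<n. w $ l * w $ l) = q"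
    using w by (simp add: q_def scalar_prod_def lessThan_atLeast0)
  have "q = v \<bullet> v - v $ 0 - v $ 0 + 1"
    using v n unfolding q_def w_def
    by (simp add: minus_scalar_prod_distrib[of _ n] scalar_prod_minus_distrib[of _ n])
  then have q_v: "q = 2 * (1 - v $ 0)" using unit by simp
  have H: "H \<in> carrier_mat n n" by (simp add: H_def)
  have rw0: "r * w $ 0 = - 1"
  proof -
    have "w $ 0 = - q / 2" using w_eq[OF n] q_v by simp
    then show ?thesis using q0 by (simp add: r_def)
  qed
  have "transpose_mat H = H" by (rule eq_matI) (auto simp: H_def)
  moreover have "H * H = 1\<^sub>m n"
  proof (rule eq_matI)
    fix i j assume "i < dim_row (1\<^sub>m n :: real mat)" "j < dim_col (1\<^sub>m n :: real mat)"
    then have i: "i < n" and j: "j < n" by auto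
    have "(H * H) $$ (i, j) =
        (\<Sum>l<n. ((if i = l then 1 else 0) - r * w $ i * w $ l) *
                ((if l = j then 1 else 0) - r * w $ l * w $ j))"
      using i j by (simp add: H_def scalar_prod_def lessThan_atLeast0)
    also have "\<dots> = (\<Sum>l<n. (if l = i then if i = j then 1 else 0 else 0)
        - (if l = i then r * w $ i * w $ j else 0) - (if l = j then r * w $ i * w $ j else 0)
        + r\<^sup>2 * w $ i * w $ j * (w $ l * w $ l))"
      by (intro sum.cong) (auto simp: power2_eq_square algebra_simps)
    also have "\<dots> = (if i = j then 1 else 0) - 2 * r * w $ i * w $ j
        + r\<^sup>2 * w $ i * w $ j * q"
      using i j by (simp add: sum.distrib sum_subtractf q_sum flip: sum_distrib_left)
    also have "\<dots> = 1\<^sub>m n $$ (i, j)" using i j q0 by (simp add: r_def power2_eq_square)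
    finally show "(H * H) $$ (i, j) = 1\<^sub>m n $$ (i, j)" .
  qed (auto simp: H_def)
  moreover have "H *\<^sub>v unit_vec n 0 = v"
  proof (rule eq_vecI)
    fix i assume "i < dim_vec v"
    then have i: "i < n" using v by simp
    have "(H *\<^sub>v unit_vec n 0) $ i = (if i = 0 then 1 else 0) - r * w $ i * w $ 0"
      using i n by (simp add: H_def)
    also have "\<dots> = (if i = 0 then 1 else 0) - (r * w $ 0) * w $ i" by simp
    also have "\<dots> = v $ i" unfolding rw0 using w_eq[OF i] by simp
    finally show "(H *\<^sub>v unit_vec n 0) $ i = v $ i" .
  qed (use v H in auto)
  ultimately show ?thesis using H by blast
qed

text \<open>Induction on the dimension.  Conjugation with a reflection that maps \<open>e\<^sub>0\<close> to a unit eigenvector makes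
\<open>e\<^sub>0\<close> an eigenvector; by symmetry the first row and column then vanish off the diagonal, and the
induction hypothesis diagonalizes the remaining block.\<close>

theorem real_spectral_theorem:
  fixes A :: "real mat"
  assumes "A \<in> carrier_mat n n" "transpose_mat A = A"
  shows "\<exists>U f. U \<in> carrier_mat n n \<and> transpose_mat U * U = 1\<^sub>m n \<and>
    transpose_mat U * A * U = mat_diag n f"
  using assms
proof (induction n arbitrary: A)
  case 0
  then show ?case
    by (intro exI[of _ "1\<^sub>m 0"] exI[of _ "\<lambda>_. 0"]) (auto simp: mat_diag_def)
next
  case (Suc m)
  note A = Suc.prems
  let ?n = "Suc m"
  obtain u e where "eigenvector A u e"
    using symmetric_real_mat_eigenvector[OF A] by auto
  then have u: "u \<in> carrier_vec ?n" "u \<noteq> 0\<^sub>v ?n" "A *\<^sub>v u = e \<cdot>\<^sub>v u"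
    using A by (auto simp: eigenvector_def)
  define v where "v = (1 / sqrt (u \<bullet> u)) \<cdot>\<^sub>v u"
  have v: "v \<in> carrier_vec ?n" using u by (simp add: v_def)
  have "v \<bullet> v = 1"
    using u(1) scalar_prod_self_pos[OF u(1,2)] by (simp add: v_def)
  from householder_reflection[OF v this] obtain H where
    H: "H \<in> carrier_mat ?n ?n" "transpose_mat H = H" "H * H = 1\<^sub>m ?n" "H *\<^sub>v unit_vec ?n 0 = v"
    by auto
  have Av: "A *\<^sub>v v = e \<cdot>\<^sub>v v"
    unfolding v_def using A(1) u by (simp add: mult_mat_vec smult_smult_assoc mult.commute)
  define B where "B = H * A * H"
  have B: "B \<in> carrier_mat ?n ?n" using H A by (simp add: B_def)
  have B_sym: "transpose_mat B = B"
    using H A by (simp add: B_def transpose_mult[of _ ?n ?n _ ?n])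
  have "H *\<^sub>v v = (H * H) *\<^sub>v unit_vec ?n 0"
    unfolding H(4)[symmetric] using H(1) by simp
  then have Hv: "H *\<^sub>v v = unit_vec ?n 0" by (simp add: H(3))
  have "B *\<^sub>v unit_vec ?n 0 = H *\<^sub>v (A *\<^sub>v (H *\<^sub>v unit_vec ?n 0))"
    unfolding B_def assoc_mult_mat[OF H(1) A(1) H(1)]
      assoc_mult_mat_vec[OF H(1) mult_carrier_mat[OF A(1) H(1)] unit_vec_carrier]
      assoc_mult_mat_vec[OF A(1) H(1) unit_vec_carrier] ..
  also have "\<dots> = e \<cdot>\<^sub>v unit_vec ?n 0"
    using H(1) v by (simp add: H(4) Av mult_mat_vec Hv)
  finally have Be: "B *\<^sub>v unit_vec ?n 0 = e \<cdot>\<^sub>v unit_vec ?n 0" .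
  have col0: "B $$ (i, 0) = (if i = 0 then e else 0)" if "i < ?n" for i
    using arg_cong[OF Be, of "\<lambda>x. x $ i"] B that by simp
  have row0: "B $$ (0, i) = (if i = 0 then e else 0)" if "i < ?n" for i
    using col0[OF that] B that arg_cong[OF B_sym, of "\<lambda>X. X $$ (i, 0)"] by simp
  define C where "C = mat m m (\<lambda>(i, j). B $$ (Suc i, Suc j))"
  have C: "C \<in> carrier_mat m m" by (simp add: C_def)
  have "transpose_mat C = C"
  proof (rule eq_matI)
    fix i j assume "i < dim_row C" "j < dim_col C"
    then have "i < m" "j < m" using C by auto
    then show "transpose_mat C $$ (i, j) = C $$ (i, j)"
      using arg_cong[OF B_sym, of "\<lambda>X. X $$ (Suc i, Suc j)"] B by (simp add: C_def)
  qed (use C in auto)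
  from Suc.IH[OF C this] obtain V g where V: "V \<in> carrier_mat m m"
    "transpose_mat V * V = 1\<^sub>m m" "transpose_mat V * C * V = mat_diag m g" by auto
  let ?E = "mat 1 1 (\<lambda>_. e)"
  have B_block: "B = four_block_mat ?E (0\<^sub>m 1 m) (0\<^sub>m m 1) C"
    by (rule eq_matI) (use B C col0 row0 in \<open>auto simp: C_def\<close>)
  define W where "W = four_block_mat (1\<^sub>m 1) (0\<^sub>m 1 m) (0\<^sub>m m 1) V"
  have W: "W \<in> carrier_mat ?n ?n" unfolding W_def using V(1) by auto
  have Wt: "transpose_mat W = four_block_mat (1\<^sub>m 1) (0\<^sub>m 1 m) (0\<^sub>m m 1) (transpose_mat V)"
    unfolding W_def by (subst transpose_four_block_mat[of _ 1 1 _ m _ m]) (use V(1) in auto)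
  have Vt: "transpose_mat V \<in> carrier_mat m m" using V(1) by simp
  have Wt_C: "transpose_mat W \<in> carrier_mat ?n ?n" using W by simp
  have WW: "transpose_mat W * W = 1\<^sub>m ?n"
  proof -
    have "transpose_mat W * W = four_block_mat (1\<^sub>m 1) (0\<^sub>m 1 m) (0\<^sub>m m 1) (1\<^sub>m m)"
      unfolding Wt unfolding W_def
      by (subst mult_four_block_mat[of _ 1 1 _ m _ m _ _ 1 _ m]) (use V Vt in auto)
    also have "\<dots> = 1\<^sub>m ?n" by (rule eq_matI) auto
    finally show ?thesis .
  qed
  have WBW: "transpose_mat W * B * W = mat_diag ?n (case_nat e g)"
  proof -
    have "transpose_mat W * B = four_block_mat ?E (0\<^sub>m 1 m) (0\<^sub>m m 1) (transpose_mat V * C)"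
      unfolding Wt B_block
      by (subst mult_four_block_mat[of _ 1 1 _ m _ m _ _ 1 _ m]) (use C Vt in auto)
    then have "transpose_mat W * B * W =
        four_block_mat ?E (0\<^sub>m 1 m) (0\<^sub>m m 1) (transpose_mat V * C) * W" by simp
    also have "\<dots> = four_block_mat ?E (0\<^sub>m 1 m) (0\<^sub>m m 1) (mat_diag m g)"
      unfolding W_def V(3)[symmetric]
      by (subst mult_four_block_mat[of _ 1 1 _ m _ m _ _ 1 _ m]) (use V(1) C Vt in auto)
    also have "\<dots> = mat_diag ?n (case_nat e g)"
      by (rule eq_matI) (auto simp: mat_diag_def split: nat.split)
    finally show ?thesis .
  qed
  define U where "U = H * W"
  have U: "U \<in> carrier_mat ?n ?n" using H W by (simp add: U_def)
  have Ut: "transpose_mat U = transpose_mat W * H"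
    using H W by (simp add: U_def transpose_mult[of _ ?n ?n _ ?n])
  have HA: "H * A \<in> carrier_mat ?n ?n" and HW: "H * W \<in> carrier_mat ?n ?n"
    using H(1) A(1) W by auto
  have "transpose_mat U * U = transpose_mat W * (H * (H * W))"
    unfolding Ut unfolding U_def by (rule assoc_mult_mat[OF Wt_C H(1) HW])
  also have "\<dots> = transpose_mat W * ((H * H) * W)"
    unfolding assoc_mult_mat[OF H(1) H(1) W] ..
  also have "\<dots> = 1\<^sub>m ?n" unfolding H(3) left_mult_one_mat[OF W] by (rule WW)
  finally have UU: "transpose_mat U * U = 1\<^sub>m ?n" .
  have "transpose_mat U * A * U = transpose_mat W * ((H * A) * (H * W))"
    unfolding Ut unfolding U_def assoc_mult_mat[OF Wt_C H(1) A(1)]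
    by (rule assoc_mult_mat[OF Wt_C HA HW])
  also have "\<dots> = transpose_mat W * B * W"
    unfolding assoc_mult_mat[OF Wt_C B W] unfolding B_def assoc_mult_mat[OF HA H(1) W] ..
  finally show ?case using U UU WBW by auto
qed

section \<open>Counting eigenvalues of a diagonalizable matrix\<close>

lemma jordan_matrix_singleton_blocks:
  "jordan_matrix (map (\<lambda>l. (1, f l)) [0..<n]) = mat_diag n f"
proof (induction n arbitrary: f)
  case 0
  show ?case by (rule eq_matI) (auto simp: mat_diag_def jordan_matrix_def)
next
  case (Suc n)
  have blocks: "map (\<lambda>l. (1, f l)) [0..<Suc n] = (1, f 0) # map (\<lambda>l. (1, f (Suc l))) [0..<n]"
    by (simp add: upt_conv_Cons map_Suc_upt[symmetric] del: upt_Suc)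
  have size: "sum_list (map fst (map (\<lambda>l. (1, f (Suc l))) [0..<n])) = n"
    by (simp add: o_def sum_list_triv)
  show ?case
    unfolding blocks jordan_matrix_Cons Suc.IH size
    by (rule eq_matI) (auto simp: mat_diag_def)
qed

text \<open>The diagonal matrix is a Jordan normal form with blocks of size 1.  Its blocks determine both the
order of each root of the characteristic polynomial and the dimension of the kernel.\<close>

lemma similar_diagonal_counts:
  fixes M :: "real mat"
  assumes M: "M \<in> carrier_mat n n" and sim: "similar_mat M (mat_diag n f)"
  shows "n_minus M = card {l. l < n \<and> f l < 0}"
    and "n_plus M = card {l. l < n \<and> f l > 0}"
    and "n_zero M = card {l. l < n \<and> f l = 0}"
proof -
  let ?js = "map (\<lambda>l. (1 :: nat, f l)) [0..<n]"
  have jnf: "jordan_nf M ?js"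
    unfolding jordan_nf_def jordan_matrix_singleton_blocks using sim by auto
  have count: "sum_list (map fst (filter (\<lambda>na. snd na = x) ?js)) = card {l. l < n \<and> f l = x}" for x
  proof -
    have "sum_list (map fst (filter (\<lambda>na. snd na = x) ?js)) = length (filter (\<lambda>l. f l = x) [0..<n])"
      by (simp add: filter_map o_def sum_list_triv)
    also have "\<dots> = card {l. l < n \<and> f l = x}"
      by (subst distinct_card[symmetric]) (auto intro!: arg_cong[of _ _ card])
    finally show ?thesis .
  qed
  have ord: "Polynomial.order x (char_poly M) = card {l. l < n \<and> f l = x}" for x
    using jordan_nf_order[OF jnf, of x] count[of x] by simp
  have "char_poly M \<noteq> 0" using degree_monic_char_poly[OF M] by auto
  then have eig: "eigenvalue M x \<longleftrightarrow> (\<exists>l<n. f l = x)" for x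
    unfolding eigenvalue_root_char_poly[OF M] order_root ord by (auto simp: card_gt_0_iff)
  have sum_orders: "(\<Sum>x | eigenvalue M x \<and> P x. Polynomial.order x (char_poly M)) =
      card {l. l < n \<and> P (f l)}" for P
  proof -
    have "{l. l < n \<and> P (f l)} = (\<Union>x\<in>{x. eigenvalue M x \<and> P x}. {l. l < n \<and> f l = x})"
      by (auto simp: eig)
    also have "card \<dots> = (\<Sum>x | eigenvalue M x \<and> P x. card {l. l < n \<and> f l = x})"
    proof (rule card_UN_disjoint)
      have "{x. eigenvalue M x \<and> P x} \<subseteq> f ` {..<n}" by (auto simp: eig)
      then show "finite {x. eigenvalue M x \<and> P x}" by (rule finite_subset) simp
    qed auto
    finally show ?thesis by (simp add: ord)
  qed
  show "n_minus M = card {l. l < n \<and> f l < 0}" "n_plus M = card {l. l < n \<and> f l > 0}"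
    unfolding n_minus_def n_plus_def by (rule sum_orders)+
  have "char_matrix M 0 = M" using M by (intro eq_matI) (auto simp: char_matrix_def)
  then have "n_zero M = dim_gen_eigenspace M 0 1"
    using M by (simp add: n_zero_def dim_gen_eigenspace_def)
  also have "\<dots> = (\<Sum>n\<leftarrow>map fst [(n, e)\<leftarrow>?js . e = 0]. min 1 n)"
    by (rule dim_gen_eigenspace[OF jnf])
  also have "\<dots> = sum_list (map fst (filter (\<lambda>na. snd na = 0) ?js))"
    by (simp add: filter_map o_def case_prod_unfold)
  finally show "n_zero M = card {l. l < n \<and> f l = 0}" unfolding count .
qed

section \<open>Inertia of a diagonalized quadratic form\<close>

definition lin_comb :: "'j set \<Rightarrow> ('j \<Rightarrow> nat \<Rightarrow> real) \<Rightarrow> ('j \<Rightarrow> real) \<Rightarrow> nat \<Rightarrow> real" where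
  "lin_comb J w y i = (\<Sum>j\<in>J. y j * w j i)"

definition quad_form :: "nat \<Rightarrow> (nat \<Rightarrow> nat \<Rightarrow> real) \<Rightarrow> (nat \<Rightarrow> real) \<Rightarrow> real" where
  "quad_form n a x = (\<Sum>i<n. \<Sum>j<n. a i j * x i * x j)"

text \<open>A subspace of dimension larger than the number of linear conditions \<open>q\<^sub>l\<close> contains a nontrivial
combination that satisfies all of them.\<close>

lemma combination_in_coordinate_kernel:
  fixes q :: "nat \<Rightarrow> nat \<Rightarrow> real"
  assumes "finite J" "finite I" "card I < card J"
  shows "\<exists>y. (\<exists>j\<in>J. y j \<noteq> 0) \<and> (\<forall>l\<in>I. (\<Sum>i<n. q l i * lin_comb J w y i) = 0)"
proof -
  obtain y where y: "\<exists>j\<in>J. y j \<noteq> 0"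
    "\<And>l. l \<in> I \<Longrightarrow> (\<Sum>j\<in>J. (\<Sum>i<n. q l i * w j i) * y j) = 0"
    using homogeneous_system_nontrivial_solution[OF assms(2,1,3), of "\<lambda>l j. \<Sum>i<n. q l i * w j i"]
    by blast
  have "(\<Sum>i<n. q l i * lin_comb J w y i) = (\<Sum>j\<in>J. (\<Sum>i<n. q l i * w j i) * y j)" for l
    unfolding lin_comb_def sum_distrib_left sum_distrib_right
    by (subst sum.swap) (simp add: algebra_simps)
  with y show ?thesis by auto
qed

text \<open>The form \<open>a\<close> is written as \<open>Q\<^sup>T F Q\<close> with \<open>F\<close> diagonal and \<open>Q\<close> invertible with inverse \<open>P\<close>.  Entries are
plain functions of two indices below \<open>n\<close>.  The inverse takes the place of the transpose of an orthogonal
matrix, because the eigenvectors of \<open>D\<^sup>-\<^sup>1 A\<close> are orthogonal for the inner product with Gram matrix \<open>D\<close>.\<close>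

locale diagonalized_form =
  fixes n :: nat and a q p :: "nat \<Rightarrow> nat \<Rightarrow> real" and f :: "nat \<Rightarrow> real"
  assumes form: "i < n \<Longrightarrow> j < n \<Longrightarrow> a i j = (\<Sum>l<n. f l * q l i * q l j)"
    and pq: "i < n \<Longrightarrow> j < n \<Longrightarrow> (\<Sum>l<n. p i l * q l j) = (if i = j then 1 else 0)"
    and qp: "l < n \<Longrightarrow> m < n \<Longrightarrow> (\<Sum>i<n. q l i * p i m) = (if l = m then 1 else 0)"
begin

abbreviation coord :: "nat \<Rightarrow> (nat \<Rightarrow> real) \<Rightarrow> real" where
  "coord l x \<equiv> (\<Sum>i<n. q l i * x i)"

lemma quad_form_sum_of_squares: "quad_form n a x = (\<Sum>l<n. f l * (coord l x)\<^sup>2)"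
proof -
  have "quad_form n a x = (\<Sum>i<n. \<Sum>j<n. \<Sum>l<n. f l * (q l i * x i) * (q l j * x j))"
    unfolding quad_form_def by (intro sum.cong) (auto simp: form sum_distrib_left sum_distrib_right algebra_simps)
  also have "\<dots> = (\<Sum>i<n. \<Sum>l<n. \<Sum>j<n. f l * (q l i * x i) * (q l j * x j))"
    by (rule sum.cong[OF refl]) (rule sum.swap)
  also have "\<dots> = (\<Sum>l<n. \<Sum>i<n. \<Sum>j<n. f l * (q l i * x i) * (q l j * x j))"
    by (rule sum.swap)
  also have "\<dots> = (\<Sum>l<n. f l * (coord l x)\<^sup>2)"
    by (intro sum.cong refl)
      (simp add: power2_eq_square sum_product sum_distrib_left algebra_simps)
  finally show ?thesis .
qed

lemma zero_if_coords_zero: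
  assumes "\<And>l. l < n \<Longrightarrow> coord l x = 0" "i < n"
  shows "x i = 0"
proof -
  have "0 = (\<Sum>l<n. p i l * coord l x)" using assms(1) by simp
  also have "\<dots> = (\<Sum>j<n. (\<Sum>l<n. p i l * q l j) * x j)"
    unfolding sum_distrib_left sum_distrib_right by (subst sum.swap) (simp add: algebra_simps)
  also have "\<dots> = (\<Sum>j<n. if j = i then x j else 0)"
    using assms(2) by (intro sum.cong) (auto simp: pq)
  also have "\<dots> = x i" using assms(2) by simp
  finally show ?thesis by simp
qed

lemma coord_of_null_vector:
  assumes null: "\<And>i. i < n \<Longrightarrow> (\<Sum>j<n. a i j * x j) = 0" and m: "m < n"
  shows "f m * coord m x = 0"
proof -
  have "0 = (\<Sum>i<n. p i m * (\<Sum>j<n. a i j * x j))" using null by simp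
  also have "\<dots> = (\<Sum>i<n. p i m * (\<Sum>l<n. f l * q l i * coord l x))"
  proof (rule sum.cong[OF refl])
    fix i assume "i \<in> {..<n}"
    then have "(\<Sum>j<n. a i j * x j) = (\<Sum>j<n. \<Sum>l<n. f l * q l i * (q l j * x j))"
      by (intro sum.cong) (auto simp: form sum_distrib_right mult.assoc)
    also have "\<dots> = (\<Sum>l<n. f l * q l i * coord l x)"
      by (subst sum.swap) (simp add: sum_distrib_left)
    finally show "p i m * (\<Sum>j<n. a i j * x j) = p i m * (\<Sum>l<n. f l * q l i * coord l x)"
      by simp
  qed
  also have "\<dots> = (\<Sum>l<n. (\<Sum>i<n. q l i * p i m) * (f l * coord l x))"
    unfolding sum_distrib_left[of "p _ m"] sum_distrib_right
    by (subst sum.swap) (simp add: algebra_simps)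
  also have "\<dots> = (\<Sum>l<n. if l = m then f l * coord l x else 0)"
    using m by (intro sum.cong) (auto simp: qp)
  also have "\<dots> = f m * coord m x" using m by simp
  finally show ?thesis by simp
qed

text \<open>If there were fewer negative coefficients than generators, some nontrivial combination of the generators
would have coordinate 0 at each negative coefficient; the form would be nonnegative there.\<close>

lemma card_le_negative_coefficients:
  assumes J: "finite J"
    and neg: "\<And>y. \<exists>j\<in>J. y j \<noteq> 0 \<Longrightarrow> quad_form n a (lin_comb J w y) < 0"
  shows "card J \<le> card {l. l < n \<and> f l < 0}"
proof (rule ccontr)
  assume "\<not> ?thesis"
  then obtain y where y: "\<exists>j\<in>J. y j \<noteq> 0"
    and 0: "\<And>l. l < n \<Longrightarrow> f l < 0 \<Longrightarrow> coord l (lin_comb J w y) = 0"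
    using combination_in_coordinate_kernel[OF J, where I = "{l. l < n \<and> f l < 0}" and n = n and q = q and w = w] by auto
  have "0 \<le> f l * (coord l (lin_comb J w y))\<^sup>2" if "l < n" for l
    using 0[OF that] by (cases "f l < 0") auto
  then have "0 \<le> quad_form n a (lin_comb J w y)"
    unfolding quad_form_sum_of_squares by (intro sum_nonneg) auto
  with neg[OF y] show False by simp
qed

lemma card_le_positive_coefficients:
  assumes J: "finite J"
    and pos: "\<And>y. \<exists>j\<in>J. y j \<noteq> 0 \<Longrightarrow> quad_form n a (lin_comb J w y) > 0"
  shows "card J \<le> card {l. l < n \<and> f l > 0}"
proof -
  interpret opp: diagonalized_form n "\<lambda>i j. - a i j" q p "\<lambda>l. - f l"
    by unfold_locales (simp_all add: form pq qp sum_negf)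
  show ?thesis
    using opp.card_le_negative_coefficients[OF J, of w] pos by (simp add: quad_form_def sum_negf)
qed

text \<open>A null vector has coordinates 0 at all nonzero coefficients.  With more generators than zero coefficients,
a nontrivial combination would also have coordinates 0 at the zero coefficients and hence vanish.\<close>

lemma card_le_zero_coefficients:
  assumes J: "finite J"
    and indep: "\<And>y. \<exists>j\<in>J. y j \<noteq> 0 \<Longrightarrow> \<exists>i<n. lin_comb J w y i \<noteq> 0"
    and null: "\<And>y i. i < n \<Longrightarrow> (\<Sum>j<n. a i j * lin_comb J w y j) = 0"
  shows "card J \<le> card {l. l < n \<and> f l = 0}"
proof (rule ccontr)
  assume "\<not> ?thesis"
  then obtain y where y: "\<exists>j\<in>J. y j \<noteq> 0"
    and 0: "\<And>l. l < n \<Longrightarrow> f l = 0 \<Longrightarrow> coord l (lin_comb J w y) = 0"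
    using combination_in_coordinate_kernel[OF J, where I = "{l. l < n \<and> f l = 0}" and n = n and q = q and w = w] by auto
  have "coord l (lin_comb J w y) = 0" if "l < n" for l
    using 0[OF that] coord_of_null_vector[OF null that] by auto
  then show False using indep[OF y] zero_if_coords_zero by blast
qed

end

section \<open>Eigenvalues of a symmetric matrix with positive row weights\<close>

text \<open>The matrix \<open>N = D\<^sup>-\<^sup>1\<^sup>/\<^sup>2 A D\<^sup>-\<^sup>1\<^sup>/\<^sup>2\<close> is symmetric, say \<open>N = U F U\<^sup>T\<close> with \<open>U\<close> orthogonal.  Then
\<open>Q = U\<^sup>T D\<^sup>1\<^sup>/\<^sup>2\<close> and its inverse \<open>P = D\<^sup>-\<^sup>1\<^sup>/\<^sup>2 U\<close> satisfy both \<open>A = Q\<^sup>T F Q\<close> and \<open>D\<^sup>-\<^sup>1 A = P F Q\<close>, so that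
the coefficients of the form \<open>A\<close> in the coordinates \<open>Q\<close> are the eigenvalues of \<open>D\<^sup>-\<^sup>1 A\<close>.\<close>

lemma diagonalized_form_if_symmetric:
  fixes A :: "real mat" and d :: "nat \<Rightarrow> real"
  assumes A: "A \<in> carrier_mat n n" and sym: "transpose_mat A = A"
    and d: "\<And>i. i < n \<Longrightarrow> d i > 0"
  shows "\<exists>q p f. diagonalized_form n (\<lambda>i j. A $$ (i, j)) q p f \<and>
    similar_mat (mat_diag n (\<lambda>i. inverse (d i)) * A) (mat_diag n f)"
proof -
  define r where "r i = sqrt (d i)" for i
  have r: "r i > 0" "d i = r i * r i" if "i < n" for i
    using d[OF that] by (simp_all add: r_def)
  have A_sym: "A $$ (j, i) = A $$ (i, j)" if "i < n" "j < n" for i j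
    using arg_cong[OF sym, of "\<lambda>X. X $$ (i, j)"] A that by simp
  define N where "N = mat n n (\<lambda>(i, j). A $$ (i, j) / (r i * r j))"
  have N: "N \<in> carrier_mat n n" by (simp add: N_def)
  have "transpose_mat N = N"
    by (rule eq_matI) (auto simp: N_def A_sym mult.commute)
  from real_spectral_theorem[OF N this] obtain U f where U: "U \<in> carrier_mat n n"
    and UU: "transpose_mat U * U = 1\<^sub>m n" and diag: "transpose_mat U * N * U = mat_diag n f" by blast
  have Ut: "transpose_mat U \<in> carrier_mat n n" using U by simp
  have UU': "U * transpose_mat U = 1\<^sub>m n"
    by (rule mat_mult_left_right_inverse[OF Ut U UU])
  have cols: "(\<Sum>i<n. U $$ (i, l) * U $$ (i, m)) = (if l = m then 1 else 0)" if "l < n" "m < n" for l m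
    using arg_cong[OF UU, of "\<lambda>X. X $$ (l, m)"] U that by (simp add: scalar_prod_def lessThan_atLeast0)
  have rows: "(\<Sum>l<n. U $$ (i, l) * U $$ (j, l)) = (if i = j then 1 else 0)" if "i < n" "j < n" for i j
    using arg_cong[OF UU', of "\<lambda>X. X $$ (i, j)"] U that by (simp add: scalar_prod_def lessThan_atLeast0)
  have "U * mat_diag n f * transpose_mat U = N"
  proof -
    have NU: "N * U \<in> carrier_mat n n" using N U by simp
    have "U * mat_diag n f = U * (transpose_mat U * (N * U))"
      unfolding diag[symmetric] assoc_mult_mat[OF Ut N U] ..
    also have "\<dots> = N * U"
      unfolding assoc_mult_mat[OF U Ut NU, symmetric] UU' by (rule left_mult_one_mat[OF NU])
    finally show ?thesis
      using assoc_mult_mat[OF N U Ut] N by (simp add: UU')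
  qed
  then have N_entry: "N $$ (i, j) = (\<Sum>l<n. f l * U $$ (i, l) * U $$ (j, l))" if "i < n" "j < n" for i j
    using U that
    by (auto simp: mat_diag_mult_right scalar_prod_def lessThan_atLeast0 mult_ac dest: arg_cong[of _ _ "\<lambda>X. X $$ (i, j)"])
  have A_entry: "A $$ (i, j) = r i * r j * N $$ (i, j)" if "i < n" "j < n" for i j
    using r[OF that(1)] r[OF that(2)] that by (simp add: N_def)
  define q where "q l i = U $$ (i, l) * r i" for l i
  define p where "p i l = U $$ (i, l) / r i" for i l
  interpret diagonalized_form n "\<lambda>i j. A $$ (i, j)" q p f
  proof
    fix i j assume ij: "i < n" "j < n"
    show "A $$ (i, j) = (\<Sum>l<n. f l * q l i * q l j)"
      unfolding A_entry[OF ij] N_entry[OF ij] by (simp add: q_def sum_distrib_left mult_ac)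
    have "(\<Sum>l<n. p i l * q l j) = r j / r i * (\<Sum>l<n. U $$ (i, l) * U $$ (j, l))"
      by (simp add: p_def q_def sum_distrib_left field_simps)
    then show "(\<Sum>l<n. p i l * q l j) = (if i = j then 1 else 0)"
      using rows[OF ij] r(1)[OF ij(1)] r(1)[OF ij(2)] by simp
    have "(\<Sum>l<n. q i l * p l j) = (\<Sum>l<n. U $$ (l, i) * U $$ (l, j))"
    proof (rule sum.cong[OF refl])
      fix l assume "l \<in> {..<n}"
      then show "q i l * p l j = U $$ (l, i) * U $$ (l, j)"
        using r(1)[of l] by (simp add: p_def q_def)
    qed
    then show "(\<Sum>l<n. q i l * p l j) = (if i = j then 1 else 0)"
      using cols[OF ij] by simp
  qed
  let ?P = "mat n n (\<lambda>(i, l). p i l)" and ?Q = "mat n n (\<lambda>(l, i). q l i)"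
  have "similar_mat_wit (mat_diag n (\<lambda>i. inverse (d i)) * A) (mat_diag n f) ?P ?Q"
  proof (rule similar_mat_witI[of _ _ n])
    show "?P * ?Q = 1\<^sub>m n"
      by (rule eq_matI) (auto simp: scalar_prod_def pq[unfolded lessThan_atLeast0])
    show "?Q * ?P = 1\<^sub>m n"
      by (rule eq_matI) (auto simp: scalar_prod_def qp[unfolded lessThan_atLeast0])
    show "mat_diag n (\<lambda>i. inverse (d i)) * A = ?P * mat_diag n f * ?Q"
    proof (rule eq_matI)
      fix i j assume "i < dim_row (?P * mat_diag n f * ?Q)" "j < dim_col (?P * mat_diag n f * ?Q)"
      then have ij: "i < n" "j < n" by auto
      have "(?P * mat_diag n f * ?Q) $$ (i, j) = (\<Sum>l<n. p i l * f l * q l j)"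
        using ij by (subst mat_diag_mult_right[of _ n]) (auto simp: scalar_prod_def lessThan_atLeast0)
      also have "\<dots> = r j / r i * N $$ (i, j)"
        unfolding N_entry[OF ij] by (simp add: p_def q_def sum_distrib_left field_simps)
      also have "\<dots> = inverse (d i) * A $$ (i, j)"
        unfolding A_entry[OF ij] using r[OF ij(1)] by (simp add: field_simps)
      also have "\<dots> = (mat_diag n (\<lambda>i. inverse (d i)) * A) $$ (i, j)"
        using ij A by (subst mat_diag_mult_left[of _ n n]) auto
      finally show "(mat_diag n (\<lambda>i. inverse (d i)) * A) $$ (i, j) = (?P * mat_diag n f * ?Q) $$ (i, j)"
        by simp
    qed (use A in \<open>auto simp: mat_diag_def\<close>)
  qed (use mult_carrier_mat[OF mat_diag_dim A] in auto)
  then show ?thesis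
    using diagonalized_form_axioms unfolding similar_mat_def by blast
qed

context
  fixes A M :: "real mat" and d :: "nat \<Rightarrow> real" and n :: nat
  assumes A: "A \<in> carrier_mat n n" and sym: "transpose_mat A = A"
    and d: "\<And>i. i < n \<Longrightarrow> d i > 0"
    and M: "M = mat_diag n (\<lambda>i. inverse (d i)) * A"
begin

lemma inertia_from_diagonalization:
  obtains q p f where "diagonalized_form n (\<lambda>i j. A $$ (i, j)) q p f"
    and "n_minus M = card {l. l < n \<and> f l < 0}"
    and "n_plus M = card {l. l < n \<and> f l > 0}"
    and "n_zero M = card {l. l < n \<and> f l = 0}"
proof -
  obtain q p f where D: "diagonalized_form n (\<lambda>i j. A $$ (i, j)) q p f"
    and sim: "similar_mat M (mat_diag n f)"
    using diagonalized_form_if_symmetric[where d = d, OF A sym d] unfolding M by blast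
  have "M \<in> carrier_mat n n" unfolding M using A mat_diag_dim by (rule mult_carrier_mat[rotated])
  then show thesis using that[OF D] similar_diagonal_counts[OF _ sim] by blast
qed

lemma card_le_n_minus:
  assumes "finite J"
    and "\<And>y. \<exists>j\<in>J. y j \<noteq> 0 \<Longrightarrow> quad_form n (\<lambda>i j. A $$ (i, j)) (lin_comb J w y) < 0"
  shows "card J \<le> n_minus M"
  by (rule inertia_from_diagonalization)
    (simp add: diagonalized_form.card_le_negative_coefficients[OF _ assms])

lemma card_le_n_plus:
  assumes "finite J"
    and "\<And>y. \<exists>j\<in>J. y j \<noteq> 0 \<Longrightarrow> quad_form n (\<lambda>i j. A $$ (i, j)) (lin_comb J w y) > 0"
  shows "card J \<le> n_plus M"
  by (rule inertia_from_diagonalization)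
    (simp add: diagonalized_form.card_le_positive_coefficients[OF _ assms])

lemma card_le_n_zero:
  assumes "finite J"
    and "\<And>y. \<exists>j\<in>J. y j \<noteq> 0 \<Longrightarrow> \<exists>i<n. lin_comb J w y i \<noteq> 0"
    and "\<And>y i. i < n \<Longrightarrow> (\<Sum>j<n. A $$ (i, j) * lin_comb J w y j) = 0"
  shows "card J \<le> n_zero M"
  by (rule inertia_from_diagonalization)
    (simp add: diagonalized_form.card_le_zero_coefficients[OF _ assms])

lemma inertia_sum: "n_minus M + n_zero M + n_plus M = n"
proof -
  obtain q p f where counts: "n_minus M = card {l. l < n \<and> f l < 0}"
    "n_plus M = card {l. l < n \<and> f l > 0}" "n_zero M = card {l. l < n \<and> (f :: nat \<Rightarrow> real) l = 0}"
    by (rule inertia_from_diagonalization)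
  have "n = card {..<n}" by simp
  also have "{..<n} = ({l. l < n \<and> f l < 0} \<union> {l. l < n \<and> f l = 0}) \<union> {l. l < n \<and> f l > 0}" by auto
  also have "card \<dots> = card ({l. l < n \<and> f l < 0} \<union> {l. l < n \<and> f l = 0}) + card {l. l < n \<and> f l > 0}"
    by (rule card_Un_disjoint) auto
  also have "card ({l. l < n \<and> f l < 0} \<union> {l. l < n \<and> f l = 0}) =
      card {l. l < n \<and> f l < 0} + card {l. l < n \<and> f l = 0}"
    by (rule card_Un_disjoint) auto
  finally show ?thesis by (simp add: counts)
qed

end

section \<open>Adjacency in a threshold graph\<close>

definition ones :: "bool list \<Rightarrow> nat set" where
  "ones b = {j. j < length b \<and> b ! j}"

definition rises :: "bool list \<Rightarrow> nat set" where
  "rises b = {j. 0 < j \<and> j < length b \<and> \<not> b ! (j - 1) \<and> b ! j}"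

definition double_zeros :: "bool list \<Rightarrow> nat set" where
  "double_zeros b = {j. 0 < j \<and> j < length b \<and> \<not> b ! (j - 1) \<and> \<not> b ! j}"

lemma finite_positions [simp]: "finite (ones b)" "finite (rises b)" "finite (double_zeros b)"
  by (auto simp: ones_def rises_def double_zeros_def)

text \<open>As the last letter is 1, each letter 0 has a successor, and it begins a factor 00 or a factor 01
accordingly.\<close>

lemma card_positions:
  assumes "b \<noteq> []" "last b"
  shows "card (ones b) + card (double_zeros b) + card (rises b) = length b"
proof -
  let ?zeros = "{i. i < length b \<and> \<not> b ! i}"
  have last: "b ! (length b - 1)" using assms by (simp add: last_conv_nth)
  have "Suc ` ?zeros = double_zeros b \<union> rises b"
  proof (intro equalityI subsetI)
    fix j assume "j \<in> Suc ` ?zeros"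
    then obtain i where i: "j = Suc i" "i < length b" "\<not> b ! i" by auto
    then have "i \<noteq> length b - 1" using last by auto
    then show "j \<in> double_zeros b \<union> rises b"
      using i by (auto simp: double_zeros_def rises_def)
  next
    fix j assume "j \<in> double_zeros b \<union> rises b"
    then show "j \<in> Suc ` ?zeros"
      by (intro image_eqI[of _ _ "j - 1"]) (auto simp: double_zeros_def rises_def)
  qed
  then have "card ?zeros = card (double_zeros b \<union> rises b)"
    by (metis card_image inj_Suc)
  also have "\<dots> = card (double_zeros b) + card (rises b)"
    by (rule card_Un_disjoint) (auto simp: double_zeros_def rises_def)
  finally have zeros: "card ?zeros = card (double_zeros b) + card (rises b)" .
  have "length b = card {..<length b}" by simp
  also have "{..<length b} = ones b \<union> ?zeros" by (auto simp: ones_def)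
  also have "card \<dots> = card (ones b) + card ?zeros"
    by (rule card_Un_disjoint) (auto simp: ones_def)
  finally show ?thesis using zeros by simp
qed

definition adj :: "bool list \<Rightarrow> nat \<Rightarrow> nat \<Rightarrow> real" where
  "adj b i j = (if i \<noteq> j \<and> b ! max i j then 1 else 0)"

lemma adj_sym: "adj b i j = adj b j i"
  by (auto simp: adj_def max.commute)

text \<open>Two distinct vertices in the support of \<open>x\<close> are adjacent, because the larger one is not vertex 0 and so
has letter 1.  The form is thus that of the all-ones matrix minus the identity.\<close>

lemma quad_form_adj_clique:
  assumes supp: "\<And>i. i < n \<Longrightarrow> i \<noteq> 0 \<Longrightarrow> \<not> b ! i \<Longrightarrow> x i = 0"
  shows "quad_form n (adj b) x = (\<Sum>i<n. x i)\<^sup>2 - (\<Sum>i<n. (x i)\<^sup>2)"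
proof -
  have "adj b i j * x i * x j = x i * x j - (if j = i then (x i)\<^sup>2 else 0)" if "i < n" "j < n" for i j
    using supp[OF that(1)] supp[OF that(2)]
    by (cases "i = 0"; cases "j = 0"; cases "i \<le> j") (auto simp: adj_def max_def power2_eq_square)
  then have "quad_form n (adj b) x = (\<Sum>i<n. \<Sum>j<n. x i * x j - (if j = i then (x i)\<^sup>2 else 0))"
    unfolding quad_form_def by (intro sum.cong) auto
  also have "\<dots> = (\<Sum>i<n. x i)\<^sup>2 - (\<Sum>i<n. (x i)\<^sup>2)"
    by (simp add: sum_subtractf power2_eq_square[of "sum x _"] sum_product)
  finally show ?thesis .
qed

text \<open>The generators \<open>e\<^sub>j - e\<^sub>0\<close> span the vectors on the clique whose coordinates add up to 0.\<close>

lemma adj_negative_on_clique: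
  assumes b0: "\<not> b ! 0" and y: "\<exists>j\<in>ones b. y j \<noteq> 0"
  defines "w \<equiv> \<lambda>j i. (if i = j then 1 else 0) - (if i = 0 then 1 else 0)"
  shows "quad_form (length b) (adj b) (lin_comb (ones b) w y) < 0"
proof -
  let ?x = "lin_comb (ones b) w y"
  have x: "?x i = (if i \<in> ones b then y i else 0) - (if i = 0 then \<Sum>j\<in>ones b. y j else 0)" for i
    by (simp add: lin_comb_def w_def right_diff_distrib sum_subtractf if_distrib[of "\<lambda>c. _ * c"] cong: if_cong)
  have "length b > 0" using y by (auto simp: ones_def)
  have "(\<Sum>i<length b. if i \<in> ones b then y i else 0) = (\<Sum>i\<in>ones b. y i)"
    by (rule sum.mono_neutral_cong_right) (auto simp: ones_def)
  then have sum0: "(\<Sum>i<length b. ?x i) = 0"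
    unfolding x sum_subtractf using \<open>length b > 0\<close> by simp
  obtain j where j: "j \<in> ones b" "y j \<noteq> 0" using y by auto
  then have "j < length b" "j \<noteq> 0" using b0 by (auto simp: ones_def intro: gr0I)
  moreover have "?x j \<noteq> 0" unfolding x using j \<open>j \<noteq> 0\<close> by simp
  ultimately have "(\<Sum>i<length b. (?x i)\<^sup>2) > 0" by (intro sum_pos2[of _ j]) auto
  moreover have "quad_form (length b) (adj b) ?x = (\<Sum>i<length b. ?x i)\<^sup>2 - (\<Sum>i<length b. (?x i)\<^sup>2)"
    by (rule quad_form_adj_clique) (unfold x, simp add: ones_def)
  ultimately show ?thesis using sum0 by simp
qed

text \<open>The generator for a factor 01 with letter 1 at \<open>j\<close> is \<open>e\<^sub>j\<^sub>-\<^sub>1\<close> plus all \<open>e\<^sub>i\<close> with \<open>i \<ge> j\<close> at which a factor 01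
ends.  A combination splits as \<open>u + v\<close> with \<open>u\<close> on letters 0 and \<open>v\<close> on letters 1, where \<open>v\<^sub>i\<close> is the
partial sum of the coefficients up to \<open>i\<close>.  As \<open>e\<^sub>j\<^sub>-\<^sub>1\<close> is adjacent to \<open>i\<close> exactly for \<open>j \<le> i\<close>, this
partial sum is also the entry of \<open>A u\<close> at \<open>i\<close>.  So each mixed term of the form is \<open>\<Sum> v\<^sub>i\<^sup>2\<close>, the term of
\<open>v\<close> alone is \<open>(\<Sum> v\<^sub>i)\<^sup>2 - \<Sum> v\<^sub>i\<^sup>2\<close> (a clique), and that of \<open>u\<close> alone is 0.\<close>

lemma adj_positive_on_rises:
  assumes y: "\<exists>j\<in>rises b. y j \<noteq> 0"
  defines "w \<equiv> \<lambda>j i. (if i = j - 1 then 1 else 0) + (if i \<in> rises b \<and> j \<le> i then 1 else 0)"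
  shows "quad_form (length b) (adj b) (lin_comb (rises b) w y) > 0"
proof -
  let ?n = "length b"
  let ?x = "lin_comb (rises b) w y"
  define u where "u i = (\<Sum>k\<in>rises b. if i = k - 1 then y k else 0)" for i
  define Y where "Y i = (\<Sum>k\<in>rises b. if k \<le> i then y k else 0)" for i
  define v where "v i = (if i \<in> rises b then Y i else 0)" for i
  have x: "?x i = u i + v i" for i
    unfolding lin_comb_def w_def u_def v_def Y_def distrib_left sum.distrib
    by (auto intro!: arg_cong2[of _ _ _ _ "(+)"] sum.cong)
  have u0: "u i = 0" if "b ! i" for i
    unfolding u_def using that by (intro sum.neutral) (auto simp: rises_def)
  have uu: "adj b i j * u i * u j = 0" for i j
    using u0[of i] u0[of j] by (auto simp: adj_def max_def)
  have cross: "(\<Sum>i<?n. adj b i j * u i) = Y j" if j: "j \<in> rises b" for j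
  proof -
    have "(\<Sum>i<?n. adj b i j * u i) = (\<Sum>k\<in>rises b. \<Sum>i<?n. adj b i j * (if i = k - 1 then y k else 0))"
      unfolding u_def sum_distrib_left by (rule sum.swap)
    also have "\<dots> = Y j"
      unfolding Y_def
    proof (rule sum.cong[OF refl])
      fix k assume k: "k \<in> rises b"
      then have k1: "k - 1 < ?n" by (auto simp: rises_def)
      have "(\<Sum>i<?n. adj b i j * (if i = k - 1 then y k else 0)) =
          (\<Sum>i<?n. if i = k - 1 then adj b (k - 1) j * y k else 0)"
        by (rule sum.cong) auto
      also have "\<dots> = adj b (k - 1) j * y k"
        using k k1 by simp
      also have "\<dots> = (if k \<le> j then y k else 0)"
      proof (cases "k \<le> j")
        case True
        then have "k - 1 < j" using k by (auto simp: rises_def)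
        then show ?thesis using True j by (simp add: adj_def rises_def max_def)
      next
        case False
        then have "j \<le> k - 1" by simp
        then show ?thesis using False k by (simp add: adj_def rises_def max_def)
      qed
      finally show "(\<Sum>i<?n. adj b i j * (if i = k - 1 then y k else 0)) = (if k \<le> j then y k else 0)" .
    qed
    finally show ?thesis .
  qed
  have uv: "(\<Sum>i<?n. \<Sum>j<?n. adj b i j * u i * v j) = (\<Sum>j<?n. (v j)\<^sup>2)"
  proof -
    have "(\<Sum>i<?n. \<Sum>j<?n. adj b i j * u i * v j) = (\<Sum>j<?n. (\<Sum>i<?n. adj b i j * u i) * v j)"
      unfolding sum_distrib_right by (rule sum.swap)
    also have "\<dots> = (\<Sum>j<?n. (v j)\<^sup>2)"
      by (rule sum.cong) (auto simp: v_def cross power2_eq_square)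
    finally show ?thesis .
  qed
  have vu: "(\<Sum>i<?n. \<Sum>j<?n. adj b i j * v i * u j) = (\<Sum>j<?n. (v j)\<^sup>2)"
    unfolding uv[symmetric] by (subst sum.swap) (simp add: adj_sym[of b] mult_ac)
  have "quad_form ?n (adj b) ?x = (\<Sum>i<?n. \<Sum>j<?n. adj b i j * u i * v j)
      + (\<Sum>i<?n. \<Sum>j<?n. adj b i j * v i * u j) + quad_form ?n (adj b) v"
    unfolding quad_form_def x sum.distrib[symmetric]
    by (intro sum.cong refl) (use uu in \<open>simp add: algebra_simps\<close>)
  also have "quad_form ?n (adj b) v = (\<Sum>i<?n. v i)\<^sup>2 - (\<Sum>i<?n. (v i)\<^sup>2)"
    by (rule quad_form_adj_clique) (auto simp: v_def rises_def)
  finally have quad: "quad_form ?n (adj b) ?x = (\<Sum>i<?n. v i)\<^sup>2 + (\<Sum>i<?n. (v i)\<^sup>2)"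
    unfolding uv vu by simp
  \<comment> \<open>The partial sum up to the first nonzero coefficient is that coefficient.\<close>
  define m where "m = Min {j \<in> rises b. y j \<noteq> 0}"
  have m: "m \<in> rises b" "y m \<noteq> 0" "\<And>j. j \<in> rises b \<Longrightarrow> y j \<noteq> 0 \<Longrightarrow> m \<le> j"
    using Min_in[of "{j \<in> rises b. y j \<noteq> 0}"] y unfolding m_def by auto
  have "Y m = (\<Sum>k\<in>rises b. if k = m then y m else 0)"
    unfolding Y_def by (rule sum.cong) (use m(3) in \<open>auto intro: antisym\<close>)
  then have "v m \<noteq> 0" using m by (simp add: v_def)
  moreover have "m < ?n" using m(1) by (simp add: rises_def)
  ultimately have "(\<Sum>i<?n. (v i)\<^sup>2) > 0" by (intro sum_pos2[of _ m]) auto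
  then show ?thesis unfolding quad by (simp add: add_nonneg_pos)
qed

text \<open>The vertices \<open>k - 1\<close> and \<open>k\<close> have the same neighbours, so the corresponding columns agree.\<close>

lemma adj_null_on_double_zeros:
  assumes "i < length b"
  defines "w \<equiv> \<lambda>j i. (if i = j then 1 else 0) - (if i = j - 1 then 1 else 0)"
  shows "(\<Sum>j<length b. adj b i j * lin_comb (double_zeros b) w y j) = 0"
proof -
  have "(\<Sum>j<length b. adj b i j * w k j) = 0" if k: "k \<in> double_zeros b" for k
  proof -
    have k1: "k - 1 < length b" using k by (auto simp: double_zeros_def)
    have "(\<Sum>j<length b. adj b i j * w k j) = (\<Sum>j<length b. if j = k then adj b i k else 0)
        - (\<Sum>j<length b. if j = k - 1 then adj b i (k - 1) else 0)"
      unfolding sum_subtractf[symmetric] w_def by (rule sum.cong) auto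
    also have "\<dots> = adj b i k - adj b i (k - 1)"
      using k k1 by (simp add: double_zeros_def)
    also have "\<dots> = 0"
      using k by (cases "i < k - 1"; cases "i = k - 1"; cases "i = k")
        (auto simp: double_zeros_def adj_def max_def)
    finally show ?thesis .
  qed
  then have "0 = (\<Sum>k\<in>double_zeros b. y k * (\<Sum>j<length b. adj b i j * w k j))" by simp
  also have "\<dots> = (\<Sum>k\<in>double_zeros b. \<Sum>j<length b. adj b i j * (y k * w k j))"
    by (simp add: sum_distrib_left mult_ac)
  also have "\<dots> = (\<Sum>j<length b. adj b i j * lin_comb (double_zeros b) w y j)"
    unfolding lin_comb_def sum_distrib_left by (rule sum.swap)
  finally show ?thesis by simp
qed

text \<open>At the last position \<open>m\<close> with a nonzero coefficient the combination has exactly this coefficient, because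
the only other generator that involves \<open>e\<^sub>m\<close> is the one at \<open>m + 1\<close>.\<close>

lemma double_zeros_independent:
  assumes y: "\<exists>j\<in>double_zeros b. y j \<noteq> 0"
  defines "w \<equiv> \<lambda>j i. (if i = j then 1 else 0) - (if i = j - 1 then 1 else 0)"
  shows "\<exists>i<length b. lin_comb (double_zeros b) w y i \<noteq> 0"
proof -
  define m where "m = Max {j \<in> double_zeros b. y j \<noteq> 0}"
  have m: "m \<in> double_zeros b" "y m \<noteq> 0" "\<And>j. j \<in> double_zeros b \<Longrightarrow> y j \<noteq> 0 \<Longrightarrow> j \<le> m"
    using Max_in[of "{j \<in> double_zeros b. y j \<noteq> 0}"] y unfolding m_def by auto
  have "y j * w j m = (if j = m then y m else 0)" if "j \<in> double_zeros b" for j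
    using m(3)[OF that] that by (cases "y j = 0") (auto simp: w_def double_zeros_def)
  then have "lin_comb (double_zeros b) w y m = y m"
    unfolding lin_comb_def using m(1) by simp
  then show ?thesis using m(1,2) by (intro exI[of _ m]) (auto simp: double_zeros_def)
qed

section \<open>Inertia of a connected threshold graph\<close>

lemma adjacency_matrix_threshold_graph:
  "adjacency_matrix (threshold_graph b) = mat (length b) (length b) (\<lambda>(i, j). adj b i j)"
  by (rule eq_matI)
    (auto simp: adjacency_matrix_def pverts_threshold_upto threshold_graph_def parcs_threshold_upto adj_def)

lemma out_degree_threshold_graph_pos:
  assumes b: "length b \<ge> 2" "last b" and i: "i < length b"
  shows "out_degree (threshold_graph b) (Suc i) > 0"
proof -
  interpret pair_graph "threshold_graph b" by (rule pair_graph_threshold_graph)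
  let ?n = "length b"
  have last: "b ! (?n - 1)" using assms by (subst last_conv_nth[symmetric]) auto
  \<comment> \<open>The last vertex is adjacent to all others, in particular to the first one.\<close>
  define e where "e = (if Suc i = ?n then (?n, 1) else (Suc i, ?n))"
  have "e \<in> parcs (threshold_graph b)"
    using last b i by (auto simp: e_def threshold_graph_def parcs_threshold_upto max_def)
  then have "e \<in> out_arcs (threshold_graph b) (Suc i)"
    by (auto simp: out_arcs_def e_def)
  then show ?thesis
    unfolding out_degree_def by (auto simp: card_gt_0_iff)
qed

text \<open>The three lower bounds and the three inertia numbers both add up to the number of vertices, which forces
equality in each bound.\<close>

theorem inertia_threshold_graph:
  assumes b: "b \<noteq> []" "\<not> hd b" "last b"
  defines "M \<equiv> normalized_adjacency_matrix (threshold_graph b)"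
  shows "n_minus M = card (ones b)" "n_zero M = card (double_zeros b)" "n_plus M = card (rises b)"
proof -
  let ?n = "length b"
  let ?A = "mat ?n ?n (\<lambda>(i, j). adj b i j)"
  let ?d = "\<lambda>i. real (out_degree (threshold_graph b) (Suc i))"
  have len: "?n \<ge> 2" using b by (cases b rule: list.exhaust; cases "tl b") auto
  have b0: "\<not> b ! 0" using b by (simp add: hd_conv_nth)
  have A: "?A \<in> carrier_mat ?n ?n" by simp
  have sym: "transpose_mat ?A = ?A" by (rule eq_matI) (auto simp: adj_sym)
  have d: "?d i > 0" if "i < ?n" for i
    using out_degree_threshold_graph_pos[OF len b(3) that] by simp
  have M: "M = mat_diag ?n (\<lambda>i. inverse (?d i)) * ?A"
    by (simp add: M_def normalized_adjacency_matrix_def inverse_degree_matrix_def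
        adjacency_matrix_threshold_graph pverts_threshold_graph)
  have quad: "quad_form ?n (\<lambda>i j. ?A $$ (i, j)) x = quad_form ?n (adj b) x" for x
    unfolding quad_form_def by (intro sum.cong) auto
  have row: "(\<Sum>j<?n. ?A $$ (i, j) * x j) = (\<Sum>j<?n. adj b i j * x j)" if "i < ?n" for i x
    using that by (intro sum.cong) auto
  have "card (ones b) \<le> n_minus M"
    by (rule card_le_n_minus[where d = ?d, OF A sym d M], assumption, simp, unfold quad)
      (rule adj_negative_on_clique[OF b0])
  moreover have "card (rises b) \<le> n_plus M"
    by (rule card_le_n_plus[where d = ?d, OF A sym d M], assumption, simp, unfold quad)
      (rule adj_positive_on_rises)
  moreover have "card (double_zeros b) \<le> n_zero M"
    by (rule card_le_n_zero[where d = ?d, OF A sym d M], assumption, simp,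
        erule double_zeros_independent, unfold row, rule adj_null_on_double_zeros)
  moreover have "n_minus M + n_zero M + n_plus M = ?n"
    by (rule inertia_sum[where d = ?d, OF A sym d M])
  moreover have "card (ones b) + card (double_zeros b) + card (rises b) = ?n"
    by (rule card_positions[OF b(1,3)])
  ultimately show "n_minus M = card (ones b)" "n_zero M = card (double_zeros b)"
    "n_plus M = card (rises b)" by linarith+
qed

section \<open>Letter counts in the block string\<close>

lemma block_string_Suc:
  "block_string (Suc k) s t =
    block_string k s t @ replicate (s (Suc k)) False @ replicate (t (Suc k)) True"
  by (simp add: block_string_def)

lemma length_block_string: "length (block_string k s t) = (\<Sum>i=1..k. s i) + (\<Sum>i=1..k. t i)"
  by (induction k) (auto simp: block_string_def)

lemma card_ones_block_string: "card (ones (block_string k s t)) = (\<Sum>i=1..k. t i)"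
proof -
  have "card (ones b) = length (filter id b)" for b
    by (simp add: ones_def length_filter_conv_card)
  moreover have "length (filter id (block_string k s t)) = (\<Sum>i=1..k. t i)"
    by (induction k) (auto simp: block_string_def)
  ultimately show ?thesis by simp
qed

text \<open>The new factor 01 is where the appended zeros end.  There is none at the border to \<open>b\<close>, since the
appended block begins with a 0.\<close>

lemma rises_append_block:
  assumes "l > 0" "m > 0"
  shows "rises (b @ replicate l False @ replicate m True) = insert (length b + l) (rises b)"
proof (rule Set.set_eqI)
  fix j
  let ?c = "b @ replicate l False @ replicate m True"
  have nth: "?c ! i = (if i < length b then b ! i else length b + l \<le> i)" if "i < length b + l + m" for i
    using that by (auto simp: nth_append)
  consider "j = 0" | "0 < j" "j < length b" | "0 < j" "j = length b" | "length b < j" "j < length b + l + m"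
    | "length b + l + m \<le> j" by linarith
  then show "j \<in> rises ?c \<longleftrightarrow> j \<in> insert (length b + l) (rises b)"
    by cases (use nth[of j] nth[of "j - 1"] assms in \<open>auto simp: rises_def\<close>)
qed

lemma card_rises_block_string:
  assumes "\<And>i. i \<in> {1..k} \<Longrightarrow> s i > 0" "\<And>i. i \<in> {1..k} \<Longrightarrow> t i > 0"
  shows "card (rises (block_string k s t)) = k"
  using assms
proof (induction k)
  case 0
  show ?case by (simp add: rises_def block_string_def)
next
  case (Suc k)
  have "length (block_string k s t) + s (Suc k) \<notin> rises (block_string k s t)"
    by (simp add: rises_def)
  then show ?case
    using Suc by (simp add: block_string_Suc rises_append_block)
qed

theorem theorem1p1:
  fixes k :: nat and s t :: "nat \<Rightarrow> nat" and \<Gamma> :: "nat pair_pre_digraph"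
  assumes "k \<ge> 1"
    and "\<And>i. i \<in> {1..k} \<Longrightarrow> s i > 0"
    and "\<And>i. i \<in> {1..k} \<Longrightarrow> t i > 0"
    and "\<Gamma> = threshold_graph (block_string k s t)"
    and "connected \<Gamma>"
  shows "n_minus (normalized_adjacency_matrix \<Gamma>) = (\<Sum>i=1..k. t i) \<and>
    int (n_zero (normalized_adjacency_matrix \<Gamma>)) = int (\<Sum>i=1..k. s i) - int k \<and>
    n_plus (normalized_adjacency_matrix \<Gamma>) = k"
proof -
  let ?b = "block_string k s t"
  obtain m where m: "k = Suc m" using assms(1) by (cases k) auto
  have s1: "s 1 > 0" and tk: "t k > 0" using assms(1) by (auto intro: assms(2,3))
  have "[1..<Suc k] = 1 # [Suc 1..<Suc k]" using assms(1) by (intro upt_conv_Cons) simp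
  then have hd: "\<not> hd ?b" using s1 by (simp add: block_string_def hd_append)
  have last: "last ?b" and ne: "?b \<noteq> []"
    using tk unfolding m block_string_Suc by auto
  note inertia = inertia_threshold_graph[OF ne hd last, folded assms(4)]
  have rises: "card (rises ?b) = k" using card_rises_block_string assms(2,3) by blast
  have "(\<Sum>i=1..k. t i) + card (double_zeros ?b) + k = (\<Sum>i=1..k. s i) + (\<Sum>i=1..k. t i)"
    using card_positions[OF ne last] unfolding rises card_ones_block_string length_block_string .
  then show ?thesis
    unfolding inertia rises card_ones_block_string by linarith
qed

end
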